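(* Let $\lambda$ and $\mu$ be infinite cardinals with $2^{\mu} \leq \lambda$, and let $X$ be a weakly initially $\lambda$-compact topological space. Then $X$ is $D$-pseudocompact for every ultrafilter $D$ over any set of cardinality $\leq \mu$.
   Context: No separation axiom is assumed on topological spaces. For an infinite cardinal $\lambda$, a topological space $X$ is weakly initially $\lambda$-compact if and only if every open cover of $X$ of cardinality at most $\lambda$ has a finite subset whose union is dense in $X$. Let $D$ be an ultrafilter over a set $I$. A point $x \in X$ is a $D$-limit point of a sequence $(O_i)_{i \in I}$ of subsets of $X$ if and only if, for every neighborhood $U$ of $x$ in $X$, $\{ i \in I \mid U \cap O_i \neq \emptyset \} \in D$. The space $X$ is $D$-pseudocompact if and only if every $I$-indexed sequence $(O_i)_{i\in I}$ of nonempty open sets of $X$ has some $D$-limit point in $X$. *)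

theory Defs
  imports "HOL-Analysis.Abstract_Topology"
begin

unbundle cardinal_syntax

(* Infinite cardinals are given, as in HOL's cardinal library, by relations r with
   Card_order r and cinfinite r; the cardinality of a set A is |A|, and ctwo ^c r is 2^r.
   An ultrafilter is kept as a family of subsets of the index set I, rather than as an
   element of the type of filters, since I need not be a whole type. *)

definition ultrafilter_over :: "'i set \<Rightarrow> 'i set set \<Rightarrow> bool" where
  "ultrafilter_over I D \<longleftrightarrow>
     D \<subseteq> Pow I \<and> I \<in> D \<and> {} \<notin> D \<and>
     (\<forall>A B. A \<in> D \<longrightarrow> B \<in> D \<longrightarrow> A \<inter> B \<in> D) \<and>
     (\<forall>A B. A \<in> D \<longrightarrow> A \<subseteq> B \<longrightarrow> B \<subseteq> I \<longrightarrow> B \<in> D) \<and>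
     (\<forall>A. A \<subseteq> I \<longrightarrow> A \<in> D \<or> I - A \<in> D)"

definition weakly_initially_compact :: "'l rel \<Rightarrow> 'a topology \<Rightarrow> bool" where
  "weakly_initially_compact r X \<longleftrightarrow>
     (\<forall>\<C>. (\<forall>U\<in>\<C>. openin X U) \<and> \<Union>\<C> = topspace X \<and> |\<C>| \<le>o r \<longrightarrow>
        (\<exists>\<F>. finite \<F> \<and> \<F> \<subseteq> \<C> \<and> X closure_of (\<Union>\<F>) = topspace X))"

(* Neighborhoods need not be open. *)
definition nbhd_of :: "'a topology \<Rightarrow> 'a \<Rightarrow> 'a set \<Rightarrow> bool" where
  "nbhd_of X x U \<longleftrightarrow> U \<subseteq> topspace X \<and> (\<exists>V. openin X V \<and> x \<in> V \<and> V \<subseteq> U)"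

(* Only the values of Os on I matter. *)
definition D_limit_point ::
    "'a topology \<Rightarrow> 'i set \<Rightarrow> 'i set set \<Rightarrow> ('i \<Rightarrow> 'a set) \<Rightarrow> 'a \<Rightarrow> bool" where
  "D_limit_point X I D Os x \<longleftrightarrow>
     x \<in> topspace X \<and> (\<forall>U. nbhd_of X x U \<longrightarrow> {i \<in> I. U \<inter> Os i \<noteq> {}} \<in> D)"

definition D_pseudocompact :: "'a topology \<Rightarrow> 'i set \<Rightarrow> 'i set set \<Rightarrow> bool" where
  "D_pseudocompact X I D \<longleftrightarrow>
     (\<forall>Os. (\<forall>i\<in>I. openin X (Os i) \<and> Os i \<noteq> {}) \<longrightarrow> (\<exists>x. D_limit_point X I D Os x))"

end

theory Submission
  imports Defs
begin

text \<open>
  If there were no \<open>D\<close>-limit point, then the exteriors of the unions \<open>\<Union>i\<in>A. Os i\<close>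
  with \<open>A \<in> D\<close> would cover the space, and there are at most \<open>2\<^sup>\<mu>\<close> of them. Finitely many of
  these exteriors, for \<open>A\<^sub>1, \<dots>, A\<^sub>n\<close> say, have dense union; but this union misses \<open>Os i\<close>
  for any \<open>i\<close> in the nonempty set \<open>A\<^sub>1 \<inter> \<dots> \<inter> A\<^sub>n\<close>.
\<close>

text \<open>The factor \<open>I\<close> handles the empty family, whose intersection is
  \<open>UNIV\<close> and need not lie in \<open>D\<close>. Each further member is absorbed by
  closure under binary intersections.\<close>

lemma ultrafilter_over_Inter:
  assumes "ultrafilter_over I D" "finite \<A>" "\<A> \<subseteq> D"
  shows "I \<inter> \<Inter>\<A> \<in> D"
  using assms(2,3)
proof (induction \<A>)
  case empty
  then show ?case using assms(1) by (simp add: ultrafilter_over_def)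
next
  case (insert A \<A>)
  then have "A \<inter> (I \<inter> \<Inter>\<A>) \<in> D"
    using assms(1) by (simp add: ultrafilter_over_def)
  moreover have "A \<inter> (I \<inter> \<Inter>\<A>) = I \<inter> \<Inter>(insert A \<A>)"
    by blast
  ultimately show ?case by simp
qed

lemma card_of_subset_Pow_ordLeq_cexp:
  assumes "Card_order r" "|I| \<le>o r" "D \<subseteq> Pow I"
  shows "|D| \<le>o ctwo ^c r"
proof -
  have "|D| \<le>o |Pow I|"
    using assms(3) by (rule card_of_mono1)
  also have "|Pow I| \<le>o |Pow (Field r)|"
  proof -
    have "|I| \<le>o |Field r|"
      using assms(2) ordIso_symmetric[OF card_of_Field_ordIso[OF assms(1)]]
      by (rule ordLeq_ordIso_trans)
    then obtain f where f: "inj_on f I" "f ` I \<subseteq> Field r"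
      by (auto simp flip: card_of_ordLeq)
    have "image f ` Pow I \<subseteq> Pow (Field r)"
      using f(2) by blast
    with inj_on_image_Pow[OF f(1)] show ?thesis
      using card_of_ordLeq by blast
  qed
  \<comment> \<open>\<open>ctwo ^c r\<close> unfolds to the cardinality of the boolean functions on
    \<open>Field r\<close>; a subset corresponds to its characteristic function.\<close>
  also have "|Pow (Field r)| =o ctwo ^c r"
    using card_of_Pow_Func[of "Field r"]
    by (simp add: cexp_def ctwo_def Field_card_of)
  finally show ?thesis .
qed

theorem theorem1:
  fixes lam :: "'l rel" and mu :: "'m rel"
    and X :: "'a topology"
    and I :: "'i set" and D :: "'i set set"
  assumes "Card_order lam" and "cinfinite lam"
    and "Card_order mu" and "cinfinite mu"
    and "ctwo ^c mu \<le>o lam"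
    and "weakly_initially_compact lam X"
    and "|I| \<le>o mu"
    and "ultrafilter_over I D"
  shows "D_pseudocompact X I D"
  unfolding D_pseudocompact_def
proof (intro allI impI)
  fix Os :: "'i \<Rightarrow> 'a set"
  assume Os: "\<forall>i\<in>I. openin X (Os i) \<and> Os i \<noteq> {}"
  \<comment> \<open>The exterior, taken as the largest open set missing every \<open>Os i\<close>
    with \<open>i \<in> A\<close>.\<close>
  define V where "V A = \<Union>{U. openin X U \<and> (\<forall>i\<in>A. U \<inter> Os i = {})}" for A
  have ultra: "A \<in> D \<or> I - A \<in> D" if "A \<subseteq> I" for A
    using assms(8) that by (simp add: ultrafilter_over_def)
  have nonempty: "{} \<notin> D"
    using assms(8) by (simp add: ultrafilter_over_def)
  have open_V: "openin X (V A)" for A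
    unfolding V_def by (rule openin_Union) simp
  have disjoint_V: "V A \<inter> Os i = {}" if "i \<in> A" for A i
    using that unfolding V_def by blast
  show "\<exists>x. D_limit_point X I D Os x"
  proof (rule ccontr)
    assume no_limit: "\<nexists>x. D_limit_point X I D Os x"
    have covered: "\<exists>A\<in>D. x \<in> V A" if "x \<in> topspace X" for x
    proof -
      obtain U where "nbhd_of X x U" and U: "{i \<in> I. U \<inter> Os i \<noteq> {}} \<notin> D"
        using no_limit \<open>x \<in> topspace X\<close> unfolding D_limit_point_def by blast
      then obtain W where W: "openin X W" "x \<in> W" "W \<subseteq> U"
        unfolding nbhd_of_def by blast
      \<comment> \<open>The indices \<open>i\<close> for which \<open>U\<close> misses
        \<open>Os i\<close>. The ultrafilter dichotomy puts this set in \<open>D\<close>, and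
        \<open>W \<subseteq> U\<close> misses the same sets, so \<open>W\<close> is one of the open
        sets making up \<open>V ?A\<close>.\<close>
      let ?A = "I - {i \<in> I. U \<inter> Os i \<noteq> {}}"
      have "?A \<in> D"
        using ultra[of "{i \<in> I. U \<inter> Os i \<noteq> {}}"] U by simp
      moreover have "x \<in> V ?A"
        unfolding V_def by (intro UnionI[of W] CollectI conjI) (use W in auto)
      ultimately show ?thesis ..
    qed
    have "\<Union>(V ` D) = topspace X"
    proof
      show "\<Union>(V ` D) \<subseteq> topspace X"
        using openin_subset[OF open_V] by blast
      show "topspace X \<subseteq> \<Union>(V ` D)"
        using covered by blast
    qed
    moreover have "|V ` D| \<le>o lam"
    proof -
      have "D \<subseteq> Pow I"
        using assms(8) by (simp add: ultrafilter_over_def)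
      then have "|D| \<le>o ctwo ^c mu"
        by (rule card_of_subset_Pow_ordLeq_cexp[OF assms(3,7)])
      then show ?thesis
        by (intro ordLeq_transitive[OF card_of_image] ordLeq_transitive[OF _ assms(5)])
    qed
    moreover have "\<forall>U\<in>V ` D. openin X U"
      using open_V by blast
    ultimately obtain \<F> where "finite \<F>" "\<F> \<subseteq> V ` D"
      and dense: "X closure_of (\<Union>\<F>) = topspace X"
      using assms(6)[unfolded weakly_initially_compact_def, rule_format, of "V ` D"] by auto
    then obtain \<A> where \<A>: "finite \<A>" "\<A> \<subseteq> D" "\<F> = V ` \<A>"
      using finite_subset_image[of \<F> V D] by blast
    \<comment> \<open>This also covers an empty \<open>\<A>\<close>, where any
      \<open>i \<in> I\<close> serves.\<close>
    have "I \<inter> \<Inter>\<A> \<noteq> {}"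
      using ultrafilter_over_Inter[OF assms(8) \<A>(1,2)] nonempty by metis
    then obtain i where i: "i \<in> I" "\<And>A. A \<in> \<A> \<Longrightarrow> i \<in> A"
      by blast
    then have "Os i \<inter> \<Union>\<F> = {}"
      using disjoint_V \<A>(3) by blast
    \<comment> \<open>Since \<open>Os i\<close> is open, missing a set means missing its closure,
      which here is the whole space.\<close>
    then have "Os i \<inter> X closure_of (\<Union>\<F>) = {}"
      using Os i(1) by (simp add: openin_Int_closure_of_eq_empty)
    moreover have "Os i \<subseteq> topspace X" "Os i \<noteq> {}"
      using Os i(1) openin_subset by auto
    ultimately show False
      using dense by auto
  qed
qed

end
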